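(* Let $g$ and $Q$ be positive integers with $g<Q$, and let $n\ge1$. If $\tilde D$ is any $g$-colored distribution of $Q(2^n-1)$ pebbles on the vertices of the path $P_n$ on $n$ vertices, then $\tilde D$ is $Q$-coverable.
   Context: A $g$-colored distribution is a placement of pebbles on the vertices of a graph in which each pebble is assigned one of $g$ colors. A color-respecting pebbling step removes two pebbles of the same color from a vertex and places one pebble of that color on an adjacent vertex. A colored distribution is $Q$-coverable if some sequence of color-respecting pebbling steps results in every vertex having at least $Q$ pebbles (of any colors). *)

theory Defs
  imports Main
begin

text \<open>
  A finite simple graph is given by its vertex set and its set of two-element edges.
\<close>

definition path_verts :: "nat \<Rightarrow> nat set" where
  "path_verts n = {..<n}"

definition path_edges :: "nat \<Rightarrow> nat set set" where
  "path_edges n = {{i, Suc i} | i. Suc i < n}"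

text \<open>
  \<open>D v c\<close> is the number of pebbles of colour \<open>c\<close> on vertex \<open>v\<close>.  The \<open>g\<close> colours
  are \<open>0, \<dots>, g - 1\<close>; not every colour needs to occur.
\<close>

type_synonym 'v colored_distribution = "'v \<Rightarrow> nat \<Rightarrow> nat"

definition is_colored_distribution ::
  "'v set \<Rightarrow> nat \<Rightarrow> 'v colored_distribution \<Rightarrow> bool" where
  "is_colored_distribution V g D \<longleftrightarrow> (\<forall>v c. D v c \<noteq> 0 \<longrightarrow> v \<in> V \<and> c < g)"

definition pebbles_at :: "nat \<Rightarrow> 'v colored_distribution \<Rightarrow> 'v \<Rightarrow> nat" where
  "pebbles_at g D v = (\<Sum>c<g. D v c)"

definition num_pebbles :: "'v set \<Rightarrow> nat \<Rightarrow> 'v colored_distribution \<Rightarrow> nat" where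
  "num_pebbles V g D = (\<Sum>v\<in>V. pebbles_at g D v)"

inductive pebbling_step ::
  "'v set set \<Rightarrow> 'v colored_distribution \<Rightarrow> 'v colored_distribution \<Rightarrow> bool"
  for E :: "'v set set" where
  "\<lbrakk>{u, v} \<in> E; u \<noteq> v; D u c \<ge> 2\<rbrakk> \<Longrightarrow>
    pebbling_step E D (D(u := (D u)(c := D u c - 2), v := (D v)(c := D v c + 1)))"

definition coverable ::
  "'v set \<Rightarrow> 'v set set \<Rightarrow> nat \<Rightarrow> nat \<Rightarrow> 'v colored_distribution \<Rightarrow> bool" where
  "coverable V E g Q D \<longleftrightarrow>
    (\<exists>D'. (pebbling_step E)\<^sup>*\<^sup>* D D' \<and> (\<forall>v\<in>V. pebbles_at g D' v \<ge> Q))"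

end

theory Submission
  imports Defs
begin

text \<open>
  Induct on the number of vertices, settling the last vertex first.  If it carries at least \<open>Q\<close>
  pebbles, it sends as many as possible to its neighbour; since \<open>g < Q\<close>, the pigeonhole principle
  yields two pebbles of equal colour at every stage.  If it carries \<open>p < Q\<close> pebbles, it is filled up
  one pebble at a time: \<open>2 ^ m\<close> pebbles of a single colour on the other \<open>m\<close> vertices suffice to bring
  one pebble to it, and the pigeonhole principle provides them because more than \<open>g * (2 ^ m - 1)\<close>
  pebbles remain there.  In both cases at least \<open>Q * (2 ^ m - 1)\<close> pebbles are left on the other
  vertices.
\<close>

section \<open>Pigeonhole over colours and colour counts at a vertex\<close>

lemma sum_less_pigeonhole:
  fixes f :: "nat \<Rightarrow> nat"
  assumes "g * b < (\<Sum>c<g. f c)"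
  obtains c where "c < g" "b < f c"
proof -
  have "\<exists>c<g. b < f c"
  proof (rule ccontr)
    assume "\<not> ?thesis"
    then have "(\<Sum>c<g. f c) \<le> (\<Sum>c<g. b)"
      by (intro sum_mono) (meson lessThan_iff not_less)
    with assms show False by simp
  qed
  then show thesis using that by blast
qed

text \<open>Additive form, so that no truncated subtraction enters the counting.\<close>

lemma pebbles_at_update_color:
  assumes "c < g" "\<And>c'. c' \<noteq> c \<Longrightarrow> D' v c' = D v c'"
  shows "pebbles_at g D' v + D v c = pebbles_at g D v + D' v c"
proof -
  have "(\<Sum>c'\<in>{..<g} - {c}. D' v c') = (\<Sum>c'\<in>{..<g} - {c}. D v c')"
    using assms(2) by (intro sum.cong) auto
  then show ?thesis
    using assms(1) by (simp add: pebbles_at_def sum.remove[of "{..<g}" c])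
qed

section \<open>Pebbling on an initial segment of the path\<close>

lemma path_edges_Suc_mono: "path_edges n \<subseteq> path_edges (Suc n)"
  unfolding path_edges_def by auto

lemma pebbling_steps_mono:
  assumes "(pebbling_step E)\<^sup>*\<^sup>* D D'" "E \<subseteq> F"
  shows "(pebbling_step F)\<^sup>*\<^sup>* D D'"
proof -
  have "pebbling_step E \<le> pebbling_step F"
    using assms(2) by (auto elim!: pebbling_step.cases intro!: pebbling_step.intros)
  then show ?thesis
    using assms(1) rtranclp_mono by blast
qed

text \<open>Both endpoints of every edge used are below \<open>n\<close>. This keeps a settled last
  vertex intact while the shorter path is treated.\<close>

lemma pebbling_steps_path_outside:
  assumes "(pebbling_step (path_edges n))\<^sup>*\<^sup>* D D'" "n \<le> w"
  shows "D' w = D w"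
  using assms(1)
proof (induction rule: rtranclp_induct)
  case (step D1 D2)
  from step.hyps(2) have "D2 w = D1 w"
  proof cases
    case (1 u v c)
    then have "u < n" "v < n"
      by (auto simp: path_edges_def doubleton_eq_iff)
    with 1 assms(2) show ?thesis by auto
  qed
  with step.IH show ?case by simp
qed simp

section \<open>Moving pebbles to or from the last vertex\<close>

text \<open>One pebble on vertex \<open>Suc m\<close> needs two of its colour on \<open>m\<close>;
  by induction each of these costs at most \<open>2 ^ m\<close> pebbles from the vertices before
  \<open>m\<close>, and pebbles already on \<open>m\<close> save a fetch.\<close>

lemma bring_pebble_to_path_end:
  fixes D :: "nat colored_distribution"
  assumes "2 ^ m \<le> (\<Sum>v<m. D v c)"
  shows "\<exists>D'. (pebbling_step (path_edges (Suc m)))\<^sup>*\<^sup>* D D' \<and> D' m c = D m c + 1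
    \<and> (\<forall>v c'. c' \<noteq> c \<longrightarrow> D' v c' = D v c')
    \<and> (\<Sum>v<m. D v c) \<le> (\<Sum>v<m. D' v c) + 2 ^ m"
  using assms
proof (induction m arbitrary: D)
  \<comment> \<open>The empty sum is 0, so the premise reads \<open>1 \<le> 0\<close>.\<close>
  case 0
  then show ?case by simp
next
  case (Suc m)
  let ?S = "\<lambda>D. \<Sum>v<m. D v c"
  have fetch: "\<exists>D'. (pebbling_step (path_edges (Suc m)))\<^sup>*\<^sup>* D D'
      \<and> D' m c = D m c + 1 \<and> (\<forall>v c'. c' \<noteq> c \<longrightarrow> D' v c' = D v c') \<and> ?S D \<le> ?S D' + 2 ^ m"
    if "2 ^ m \<le> ?S D" for D
    using Suc.IH that by blast
  have pos: "(1::nat) \<le> 2 ^ m" by simp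
  \<comment> \<open>Gathering the pair may lose at most \<open>2 ^ Suc m - 2\<close> pebbles of
    colour \<open>c\<close> on the vertices up to \<open>m\<close>, since the final move to
    \<open>Suc m\<close> removes the remaining 2 of the budget.\<close>
  have "\<exists>D'. (pebbling_step (path_edges (Suc m)))\<^sup>*\<^sup>* D D'
      \<and> 2 \<le> D' m c \<and> (\<forall>v c'. c' \<noteq> c \<longrightarrow> D' v c' = D v c')
      \<and> ?S D + D m c + 2 \<le> ?S D' + D' m c + 2 ^ Suc m"
  proof -
    consider "2 \<le> D m c" | "D m c = 1" | "D m c = 0" by linarith
    then show ?thesis
    proof cases
      case 1
      then show ?thesis using pos by (intro exI[of _ D]) auto
    next
      case 2
      then have "2 ^ m \<le> ?S D" using Suc.prems pos by simp
      from fetch[of D, OF this] obtain D1 where D1: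
        "(pebbling_step (path_edges (Suc m)))\<^sup>*\<^sup>* D D1" "D1 m c = D m c + 1"
        "\<forall>v c'. c' \<noteq> c \<longrightarrow> D1 v c' = D v c'" "?S D \<le> ?S D1 + 2 ^ m" by blast
      have "?S D + D m c + 2 \<le> ?S D1 + D1 m c + 2 ^ Suc m"
        using D1(2,4) 2 pos unfolding power_Suc by linarith
      moreover have "2 \<le> D1 m c"
        using D1(2) 2 by simp
      ultimately show ?thesis
        using D1(1,3) by blast
    next
      case 3
      then have "2 ^ m \<le> ?S D" using Suc.prems by simp
      from fetch[of D, OF this] obtain D1 where D1:
        "(pebbling_step (path_edges (Suc m)))\<^sup>*\<^sup>* D D1" "D1 m c = D m c + 1"
        "\<forall>v c'. c' \<noteq> c \<longrightarrow> D1 v c' = D v c'" "?S D \<le> ?S D1 + 2 ^ m" by blast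
      \<comment> \<open>With none on \<open>m\<close>, all \<open>2 ^ Suc m\<close> pebbles lie
        before it, so the first fetch leaves enough for a second.\<close>
      have "2 ^ m \<le> ?S D1" using D1(4) 3 Suc.prems by simp
      from fetch[of D1, OF this] obtain D2 where D2:
        "(pebbling_step (path_edges (Suc m)))\<^sup>*\<^sup>* D1 D2" "D2 m c = D1 m c + 1"
        "\<forall>v c'. c' \<noteq> c \<longrightarrow> D2 v c' = D1 v c'" "?S D1 \<le> ?S D2 + 2 ^ m" by blast
      have "?S D + D m c + 2 \<le> ?S D2 + D2 m c + 2 ^ Suc m"
        using D1(2,4) D2(2,4) 3 unfolding power_Suc by linarith
      moreover have "2 \<le> D2 m c"
        using D1(2) D2(2) by simp
      moreover have "\<forall>v c'. c' \<noteq> c \<longrightarrow> D2 v c' = D v c'"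
        using D1(3) D2(3) by simp
      ultimately show ?thesis
        using rtranclp_trans[OF D1(1) D2(1)] by blast
    qed
  qed
  then obtain D1 where D1: "(pebbling_step (path_edges (Suc m)))\<^sup>*\<^sup>* D D1" "2 \<le> D1 m c"
      "\<forall>v c'. c' \<noteq> c \<longrightarrow> D1 v c' = D v c'"
      "?S D + D m c + 2 \<le> ?S D1 + D1 m c + 2 ^ Suc m" by blast
  have end_eq: "D1 (Suc m) = D (Suc m)"
    using pebbling_steps_path_outside[OF D1(1)] by simp
  define D' where "D' = D1(m := (D1 m)(c := D1 m c - 2), Suc m := (D1 (Suc m))(c := D1 (Suc m) c + 1))"
  have "{m, Suc m} \<in> path_edges (Suc (Suc m))"
    by (auto simp: path_edges_def)
  then have "pebbling_step (path_edges (Suc (Suc m))) D1 D'"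
    unfolding D'_def using D1(2) by (intro pebbling_step.intros) auto
  with pebbling_steps_mono[OF D1(1) path_edges_Suc_mono]
  have "(pebbling_step (path_edges (Suc (Suc m))))\<^sup>*\<^sup>* D D'"
    by auto
  moreover have "D' (Suc m) c = D (Suc m) c + 1"
    by (simp add: D'_def end_eq)
  moreover have "\<forall>v c'. c' \<noteq> c \<longrightarrow> D' v c' = D v c'"
    using D1(3) by (simp add: D'_def)
  moreover have "(\<Sum>v<Suc m. D v c) \<le> (\<Sum>v<Suc m. D' v c) + 2 ^ Suc m"
  proof -
    have "?S D' = ?S D1"
      by (intro sum.cong) (auto simp: D'_def)
    moreover have "D' m c + 2 = D1 m c"
      using D1(2) by (simp add: D'_def)
    ultimately show ?thesis
      using D1(4) unfolding sum.lessThan_Suc by linarith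
  qed
  ultimately show ?case by blast
qed

text \<open>The term \<open>k * 2 ^ m\<close> pays for the \<open>k\<close> pebbles;
  \<open>g * (2 ^ m - 1)\<close> is the largest total with no colour reaching \<open>2 ^ m\<close>,
  so while a pebble is still due some colour can supply it.\<close>

lemma fill_path_end:
  fixes D :: "nat colored_distribution"
  assumes "k * 2 ^ m + g * (2 ^ m - 1) \<le> (\<Sum>v<m. pebbles_at g D v)"
  shows "\<exists>D'. (pebbling_step (path_edges (Suc m)))\<^sup>*\<^sup>* D D'
    \<and> pebbles_at g D' m = pebbles_at g D m + k
    \<and> (\<Sum>v<m. pebbles_at g D v) \<le> (\<Sum>v<m. pebbles_at g D' v) + k * 2 ^ m"
  using assms
proof (induction k arbitrary: D)
  case 0
  then show ?case by auto
next
  case (Suc k)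
  have "g * (2 ^ m - 1) < Suc k * 2 ^ m + g * (2 ^ m - 1)" by simp
  also have "\<dots> \<le> (\<Sum>v<m. pebbles_at g D v)" by (rule Suc.prems)
  also have "\<dots> = (\<Sum>c<g. \<Sum>v<m. D v c)"
    unfolding pebbles_at_def by (rule sum.swap)
  finally obtain c where c: "c < g" "2 ^ m - 1 < (\<Sum>v<m. D v c)"
    by (rule sum_less_pigeonhole)
  then have "2 ^ m \<le> (\<Sum>v<m. D v c)" by simp
  from bring_pebble_to_path_end[of m D c, OF this] obtain D1 where D1:
    "(pebbling_step (path_edges (Suc m)))\<^sup>*\<^sup>* D D1" "D1 m c = D m c + 1"
    "\<And>v c'. c' \<noteq> c \<Longrightarrow> D1 v c' = D v c'"
    "(\<Sum>v<m. D v c) \<le> (\<Sum>v<m. D1 v c) + 2 ^ m" by blast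
  have upd: "pebbles_at g D1 v + D v c = pebbles_at g D v + D1 v c" for v
    using pebbles_at_update_color[of c g D1 v D] c(1) D1(3) by simp
  \<comment> \<open>Only colour \<open>c\<close> changes, so the total loss equals the loss in that
    colour.\<close>
  have "(\<Sum>v<m. pebbles_at g D1 v) + (\<Sum>v<m. D v c)
      = (\<Sum>v<m. pebbles_at g D v) + (\<Sum>v<m. D1 v c)"
    unfolding sum.distrib[symmetric] using upd by simp
  with D1(4) have cost:
    "(\<Sum>v<m. pebbles_at g D v) \<le> (\<Sum>v<m. pebbles_at g D1 v) + 2 ^ m" by linarith
  with Suc.prems have "k * 2 ^ m + g * (2 ^ m - 1) \<le> (\<Sum>v<m. pebbles_at g D1 v)" by simp
  from Suc.IH[OF this] obtain D2 where D2:
    "(pebbling_step (path_edges (Suc m)))\<^sup>*\<^sup>* D1 D2"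
    "pebbles_at g D2 m = pebbles_at g D1 m + k"
    "(\<Sum>v<m. pebbles_at g D1 v) \<le> (\<Sum>v<m. pebbles_at g D2 v) + k * 2 ^ m" by blast
  have "pebbles_at g D2 m = pebbles_at g D m + Suc k"
    using D2(2) upd[of m] D1(2) by simp
  moreover have "(\<Sum>v<m. pebbles_at g D v) \<le> (\<Sum>v<m. pebbles_at g D2 v) + Suc k * 2 ^ m"
    using cost D2(3) by simp
  ultimately show ?case
    using rtranclp_trans[OF D1(1) D2(1)] by blast
qed

text \<open>Before each move \<open>u\<close> holds at least \<open>g + 2\<close> pebbles, so two of
  them share a colour; the reserve of \<open>g\<close> is never spent.\<close>

lemma move_pebbles_along_edge:
  assumes "{u, v} \<in> E" "u \<noteq> v" "g + 2 * k \<le> pebbles_at g D u"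
  shows "\<exists>D'. (pebbling_step E)\<^sup>*\<^sup>* D D'
    \<and> pebbles_at g D' u + 2 * k = pebbles_at g D u
    \<and> pebbles_at g D' v = pebbles_at g D v + k
    \<and> (\<forall>w. w \<noteq> u \<longrightarrow> w \<noteq> v \<longrightarrow> D' w = D w)"
  using assms(3)
proof (induction k arbitrary: D)
  case 0
  then show ?case by auto
next
  case (Suc k)
  have "g * 1 < (\<Sum>c<g. D u c)"
    using Suc.prems by (simp add: pebbles_at_def)
  then obtain c where c: "c < g" "1 < D u c"
    by (rule sum_less_pigeonhole)
  define D1 where "D1 = D(u := (D u)(c := D u c - 2), v := (D v)(c := D v c + 1))"
  have step: "pebbling_step E D D1"
    unfolding D1_def using assms(1,2) c(2) by (intro pebbling_step.intros) auto
  have u: "pebbles_at g D1 u + 2 = pebbles_at g D u"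
    using pebbles_at_update_color[of c g D1 u D] c assms(2) by (simp add: D1_def)
  have v: "pebbles_at g D1 v = pebbles_at g D v + 1"
    using pebbles_at_update_color[of c g D1 v D] c assms(2) by (simp add: D1_def)
  have "g + 2 * k \<le> pebbles_at g D1 u"
    using u Suc.prems by simp
  from Suc.IH[OF this] obtain D2 where D2: "(pebbling_step E)\<^sup>*\<^sup>* D1 D2"
    "pebbles_at g D2 u + 2 * k = pebbles_at g D1 u"
    "pebbles_at g D2 v = pebbles_at g D1 v + k"
    "\<forall>w. w \<noteq> u \<longrightarrow> w \<noteq> v \<longrightarrow> D2 w = D1 w" by blast
  have "(pebbling_step E)\<^sup>*\<^sup>* D D2"
    using step D2(1) by (rule converse_rtranclp_into_rtranclp)
  moreover have "pebbles_at g D2 u + 2 * Suc k = pebbles_at g D u"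
    using D2(2) u by simp
  moreover have "pebbles_at g D2 v = pebbles_at g D v + Suc k"
    using D2(3) v by simp
  moreover have "\<forall>w. w \<noteq> u \<longrightarrow> w \<noteq> v \<longrightarrow> D2 w = D w"
    using D2(4) by (simp add: D1_def)
  ultimately show ?case by blast
qed

section \<open>Settling the last vertex and induction along the path\<close>

lemma settle_path_end:
  fixes D :: "nat colored_distribution"
  assumes "g < Q" and total: "Q * (2 ^ Suc m - 1) \<le> num_pebbles (path_verts (Suc m)) g D"
  shows "\<exists>D'. (pebbling_step (path_edges (Suc m)))\<^sup>*\<^sup>* D D' \<and> Q \<le> pebbles_at g D' m
    \<and> Q * (2 ^ m - 1) \<le> num_pebbles (path_verts m) g D'"
proof -
  let ?S = "\<lambda>D. \<Sum>v<m. pebbles_at g D v"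
  \<comment> \<open>\<open>Y\<close> stands for \<open>2 ^ m - 1\<close>, which makes the hypothesis
    and the goal subtraction-free: \<open>Q * (2 ^ Suc m - 1)\<close> is
    \<open>2 * (Q * Y) + Q\<close>.\<close>
  obtain Y :: nat where Y: "2 ^ m = Suc Y"
    by (metis not0_implies_Suc power_not_zero zero_neq_numeral)
  have total': "2 * (Q * Y) + Q \<le> ?S D + pebbles_at g D m"
    using total by (simp add: num_pebbles_def path_verts_def Y algebra_simps)
  show ?thesis
  proof (cases "Q \<le> pebbles_at g D m")
    case False
    define k where "k = Q - pebbles_at g D m"
    have bounds: "k * Y \<le> Q * Y" "g * Y \<le> Q * Y"
      using assms(1) by (simp_all add: k_def)
    have k: "k + pebbles_at g D m = Q"
      using False by (simp add: k_def)
    \<comment> \<open>The other vertices hold at least \<open>2 * (Q * Y) + k\<close> pebbles. One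
      copy of \<open>Q * Y\<close> covers \<open>k * Y\<close>, the other covers
      \<open>g * Y\<close>; the latter copy is what remains after filling.\<close>
    have "k * 2 ^ m + g * (2 ^ m - 1) \<le> ?S D"
      unfolding Y mult_Suc_right diff_Suc_1 using bounds k total' by linarith
    from fill_path_end[OF this] obtain D' where D':
      "(pebbling_step (path_edges (Suc m)))\<^sup>*\<^sup>* D D'"
      "pebbles_at g D' m = pebbles_at g D m + k"
      "?S D \<le> ?S D' + k * 2 ^ m" by blast
    have "Q * Y \<le> ?S D'"
      using D'(3) bounds k total' unfolding Y mult_Suc_right by linarith
    with D'(1,2) k show ?thesis
      by (intro exI[of _ D']) (simp add: num_pebbles_def path_verts_def Y)
  next
    case True
    show ?thesis
    proof (cases m)
      \<comment> \<open>There is no neighbour to send to, but nothing is required of the empty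
        rest.\<close>
      case 0
      with True show ?thesis by (intro exI[of _ D]) simp
    next
      case (Suc l)
      \<comment> \<open>The most moves that leave \<open>Q\<close> pebbles on \<open>m\<close>;
        rounding strands at most one extra pebble.\<close>
      define k where "k = (pebbles_at g D m - Q) div 2"
      have k: "Q + 2 * k \<le> pebbles_at g D m" "pebbles_at g D m \<le> Q + 2 * k + 1"
        using True by (simp_all add: k_def)
      have "{m, l} \<in> path_edges (Suc m)"
        by (auto simp: path_edges_def Suc)
      moreover have "g + 2 * k \<le> pebbles_at g D m"
        using k(1) assms(1) by simp
      ultimately obtain D' where D': "(pebbling_step (path_edges (Suc m)))\<^sup>*\<^sup>* D D'"
        "pebbles_at g D' m + 2 * k = pebbles_at g D m"
        "pebbles_at g D' l = pebbles_at g D l + k"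
        "\<forall>w. w \<noteq> m \<longrightarrow> w \<noteq> l \<longrightarrow> D' w = D w"
        using move_pebbles_along_edge[of m l "path_edges (Suc m)" g k D] Suc by auto
      have "(\<Sum>v<l. pebbles_at g D' v) = (\<Sum>v<l. pebbles_at g D v)"
        using D'(4) Suc by (intro sum.cong) (auto simp: pebbles_at_def)
      then have "?S D' = ?S D + k"
        using D'(3) Suc by simp
      \<comment> \<open>Here \<open>2 * (?S D + k) \<ge> ?S D + 2 * k \<ge> 2 * (Q * Y) - 1\<close>,
        and integrality absorbs the 1 lost to rounding.\<close>
      then have "Q * Y \<le> ?S D'"
        using k total' by linarith
      moreover have "Q \<le> pebbles_at g D' m"
        using D'(2) k(1) by linarith
      ultimately show ?thesis
        using D'(1) by (intro exI[of _ D']) (simp add: num_pebbles_def path_verts_def Y)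
    qed
  qed
qed

text \<open>A lower bound replaces the exact pebble count because settling the end guarantees only a
  lower bound for the rest, and the induction must apply to that.\<close>

lemma path_coverable:
  fixes D :: "nat colored_distribution"
  assumes "g < Q" "Q * (2 ^ n - 1) \<le> num_pebbles (path_verts n) g D"
  shows "coverable (path_verts n) (path_edges n) g Q D"
  using assms(2)
proof (induction n arbitrary: D)
  case 0
  then show ?case by (auto simp: coverable_def path_verts_def)
next
  case (Suc m)
  from settle_path_end[OF assms(1) Suc.prems] obtain D1 where D1:
    "(pebbling_step (path_edges (Suc m)))\<^sup>*\<^sup>* D D1" "Q \<le> pebbles_at g D1 m"
    "Q * (2 ^ m - 1) \<le> num_pebbles (path_verts m) g D1" by blast
  from Suc.IH[OF D1(3)] obtain D2 where D2: "(pebbling_step (path_edges m))\<^sup>*\<^sup>* D1 D2"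
    "\<forall>v<m. Q \<le> pebbles_at g D2 v"
    by (auto simp: coverable_def path_verts_def)
  have "pebbles_at g D2 m = pebbles_at g D1 m"
    using pebbling_steps_path_outside[OF D2(1)] by (simp add: pebbles_at_def)
  with D1(2) D2(2) have "\<forall>v\<in>path_verts (Suc m). Q \<le> pebbles_at g D2 v"
    by (auto simp: path_verts_def less_Suc_eq)
  with rtranclp_trans[OF D1(1) pebbling_steps_mono[OF D2(1) path_edges_Suc_mono]]
  show ?case unfolding coverable_def by blast
qed

theorem theorem2p4:
  fixes g Q n :: nat and D :: "nat colored_distribution"
  assumes "0 < g" and "0 < Q" and "g < Q" and "1 \<le> n"
    and "is_colored_distribution (path_verts n) g D"
    and "num_pebbles (path_verts n) g D = Q * (2 ^ n - 1)"
  shows "coverable (path_verts n) (path_edges n) g Q D"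
  using path_coverable assms(3,6) by simp

end
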